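(* Let $\mathcal{M} = \langle \mathbf{U}, \mathbf{V}, \mathbf{F}\rangle$ be a structural causal model describing the data-generating process, with outcome $Y \in \mathbf{V}$, and let $\mathcal{M}_{\widehat{Y}} = \langle \widetilde{\mathbf{U}}, \widetilde{\mathbf{V}}, \widetilde{\mathbf{F}}\rangle$ be a structural causal model describing a prediction algorithm, in which $\widehat{Y}$ is the only generated variable in $\widetilde{\mathbf{V}}$, $\widehat{Y}$ is generated deterministically, and $\mathbf{PA}_{\widehat{Y}} \equiv \mathbf{PA}_Y$. Assume that the background variables satisfy $U_i \perp\!\!\!\perp U_j$ for all $i \neq j$. Consider a directed path $\pi: V_1 = X \to \dots \to W \to Y$ in $\mathcal{M}$, where $X$ is a protected attribute. If $\widehat{Y}$ satisfies predictive parity in derivatives (PPD) along $\pi$, then $\widehat{Y}$ also satisfies causal predictive parity for all counterfactual contrasts in $X$ along $\pi$ in the setting $\mathbf{Z} = \mathbf{PA}_Y$; that is, for all values $x_0, x_1$ of $X$, $$\mathrm{E}[Y(\pi(x_1)) \mid \mathbf{PA}_Y] - \mathrm{E}[Y(\pi(x_0)) \mid \mathbf{PA}_Y] = \mathrm{E}[\widehat{Y}(\pi(x_1)) \mid \mathbf{PA}_Y] - \mathrm{E}[\widehat{Y}(\pi(x_0)) \mid \mathbf{PA}_Y].$$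
   Context: **Structural causal model (SCM).** A triple $\langle \mathbf{U}, \mathbf{V}, \mathbf{F}\rangle$, where $\mathbf{U}$ is a set of background variables determined outside the model and equipped with a probability distribution; $\mathbf{V} = \{V_1,\dots,V_n\}$ is a set of endogenous variables; and $\mathbf{F} = \{f_1,\dots,f_n\}$ is a set of functions (mechanisms), $V_i = f_i(\mathbf{PA}_{V_i}, U_i)$, with $U_i \subseteq \mathbf{U}$ and $\mathbf{PA}_{V_i} \subseteq \mathbf{V}\setminus\{V_i\}$ (the parents of $V_i$), such that the system has a unique solution $\mathbf{V}(\mathbf{u})$ for each $\mathbf{u}$. We also write $f_{V_i}$ for $f_i$ and $U_{V_i}$ for $U_i$. The causal diagram has an arrow $V_i \to V_j$ whenever $V_i \in \mathbf{PA}_{V_j}$. **Directed paths.** A directed path $\pi = (V_1,\dots,V_{|\pi|})$ is an ordered sequence of variables in which each variable is a parent of the next; here $|\pi|$ is the number of variables in the sequence. **Interventions.** Setting $V_i = v_i$ replaces the mechanism $f_i$ by the constant $v_i$; $V_j(v_i)$ is the resulting potential outcome. For a path $\pi$ from $X$ to $Y$, $Y(\pi(x))$ is the nested counterfactual in which $X$ is set to $x$ only along $\pi$, all other dependence on $X$ being left as it is. For example, with arrows $X \to Y$, $X \to W \to Y$ and $\pi: X\to W\to Y$, one has $Y(\pi(x)) = Y(W(x), X)$. $\widehat{Y}(\pi(x))$ is defined likewise in $\mathcal{M}_{\widehat{Y}}$ along the path corresponding to $\pi$ (with $Y$ replaced by $\widehat{Y}$). **Two corresponding SCMs.** For each variable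 $V_k \in \mathbf{V}$ there is a corresponding variable $\widetilde{V}_k \in \widetilde{\mathbf{V}}$, the one corresponding to $Y$ being $\widehat{Y}$. Each $\widetilde{V}_k$ is either equivalent to $V_k$ ($\widetilde{V}_k \equiv V_k$) or generated, i.e. produced artificially by the prediction algorithm by its own mechanism $f_{\widetilde{V}_k}$ (possibly with other parents). "Only $\widehat{Y}$ is generated" means $\widetilde{V}_k \equiv V_k$ for all variables other than the outcome (so also $\widetilde{\mathbf{U}}$ coincides with $\mathbf{U}\setminus U_Y$, apart from background variables of $\widehat{Y}$). "Generated deterministically" means $\widehat{Y}$ has no background variables, $\widetilde{U}_{\widehat{Y}} = \emptyset$, so $\widehat{Y} = f_{\widehat{Y}}(\mathbf{PA}_{\widehat{Y}})$. **PPD.** For a path $\pi: V_1 \to \dots \to V_{|\pi|} = Y$ in $\mathcal{M}$, $\widehat{Y}$ satisfies predictive parity in derivatives along $\pi$ if $$\frac{\partial}{\partial \widetilde{v}_{k-1}} \mathrm{E}[\widetilde{V}_k \mid \widetilde{\mathbf{PA}}_{V_k} = \mathbf{p}] = \frac{\partial}{\partial v_{k-1}} \mathrm{E}[V_k \mid \mathbf{PA}_{V_k} = \mathbf{p}] \qquad \text{for all } k \in \{2,\dots,|\pi|\} \text{ and all } \mathbf{p},$$ where $\widetilde{\mathbf{PA}}_{V_k}$ are the variables in $\mathcal{M}_{\widehat{Y}}$ corresponding to $\mathbf{PA}_{V_k}$, and both conditional expectations are assumed differentiable in $\mathbf{p}$. When only $\widehat{Y}$ is generated, deterministically and with no inputs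 other than $\mathbf{PA}_Y$, this reduces to the single condition $\frac{\partial}{\partial w} f_{\widehat{Y}}(\mathbf{p}) = \frac{\partial}{\partial w}\mathrm{E}[Y \mid \mathbf{PA}_Y = \mathbf{p}]$ for all $\mathbf{p}$, where $W$ is the parent of $Y$ on $\pi$. **Causal predictive parity.** $\widehat{Y}$ satisfies causal predictive parity with respect to a counterfactual contrast along $\pi: X \to \dots \to Y$ for a change in $X$ from $x_0$ to $x_1$ in setting $\mathbf{Z}$ if $$\mathrm{E}[Y(\pi(x_1)) \mid \mathbf{Z}] - \mathrm{E}[Y(\pi(x_0)) \mid \mathbf{Z}] = \mathrm{E}[\widehat{Y}(\pi(x_1)) \mid \mathbf{Z}] - \mathrm{E}[\widehat{Y}(\pi(x_0)) \mid \mathbf{Z}].$$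
   Formalization: The background variables are assumed mutually independent, since pairwise independence makes the claim false (U_Y = cos 2π(U_X+U_W), W = X+U_W, Y = U_Y); E[V_k | PA = p] is fixed at every p, and the counterfactuals are assumed integrable. *)

theory Defs
  imports "HOL-Probability.Probability"
begin

section \<open>Structural causal models\<close>

text \<open>
  Variables are names: \<open>'v\<close> for endogenous, \<open>'u\<close> for background variables. Endogenous variables
  are real valued. The background variables are random variables on a probability space \<open>sample\<close>,
  so that two models can share background variables and be compared almost surely.
  \<open>exo_of M k\<close> is the set of background variables entering the mechanism of \<open>k\<close>.
\<close>

record ('v, 'u, 'w, 'b) scm =
  sample :: "'w measure"
  exo :: "'u set"
  exo_space :: "'u \<Rightarrow> 'b measure"
  exo_var :: "'u \<Rightarrow> 'w \<Rightarrow> 'b"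
  endo :: "'v set"
  parents :: "'v \<Rightarrow> 'v set"
  exo_of :: "'v \<Rightarrow> 'u set"
  mech :: "'v \<Rightarrow> ('v \<Rightarrow> real) \<Rightarrow> ('u \<Rightarrow> 'b) \<Rightarrow> real"

definition solves :: "('v, 'u, 'w, 'b) scm \<Rightarrow> ('u \<Rightarrow> 'b) \<Rightarrow> ('v \<Rightarrow> real) \<Rightarrow> bool" where
  "solves M u v \<longleftrightarrow> v \<in> endo M \<rightarrow>\<^sub>E UNIV \<and>
     (\<forall>k\<in>endo M. v k = mech M k (restrict v (parents M k)) (restrict u (exo_of M k)))"

definition solution :: "('v, 'u, 'w, 'b) scm \<Rightarrow> ('u \<Rightarrow> 'b) \<Rightarrow> 'v \<Rightarrow> real" where
  "solution M u = (THE v. solves M u v)"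

text \<open>Acyclicity is not required, only unique solvability.\<close>

locale structural_causal_model = prob_space "sample M"
  for M :: "('v, 'u, 'w, 'b) scm" +
  assumes finite_endo: "finite (endo M)"
    and exo_var_measurable:
      "u \<in> exo M \<Longrightarrow> exo_var M u \<in> measurable (sample M) (exo_space M u)"
    and parents_subset: "k \<in> endo M \<Longrightarrow> parents M k \<subseteq> endo M - {k}"
    and exo_of_subset: "k \<in> endo M \<Longrightarrow> exo_of M k \<subseteq> exo M"
    and mech_measurable:
      "k \<in> endo M \<Longrightarrow> (\<lambda>(v, u). mech M k v u) \<in> borel_measurable
         (PiM (parents M k) (\<lambda>_. borel) \<Otimes>\<^sub>M PiM (exo_of M k) (exo_space M))"
    and unique_solution: "w \<in> space (PiM (exo M) (exo_space M)) \<Longrightarrow> \<exists>!v. solves M w v"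
    and solution_measurable:
      "k \<in> endo M \<Longrightarrow> (\<lambda>u. solution M u k) \<in> borel_measurable (PiM (exo M) (exo_space M))"

text \<open>The random vector of the background variables entering the mechanism of \<open>k\<close>.\<close>

definition exo_vec :: "('v, 'u, 'w, 'b) scm \<Rightarrow> 'v \<Rightarrow> 'w \<Rightarrow> 'u \<Rightarrow> 'b" where
  "exo_vec M k \<omega> = (\<lambda>u\<in>exo_of M k. exo_var M u \<omega>)"

definition endo_val :: "('v, 'u, 'w, 'b) scm \<Rightarrow> 'w \<Rightarrow> 'v \<Rightarrow> real" where
  "endo_val M \<omega> = solution M (\<lambda>u\<in>exo M. exo_var M u \<omega>)"

text \<open>Mutual (not merely pairwise) independence of the families \<open>U\<^sub>k\<close>.\<close>

definition independent_exo :: "('v, 'u, 'w, 'b) scm \<Rightarrow> bool" where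
  "independent_exo M \<longleftrightarrow>
     prob_space.indep_vars (sample M) (\<lambda>k. PiM (exo_of M k) (exo_space M)) (exo_vec M) (endo M)"


section \<open>Directed paths and path-specific counterfactuals\<close>

definition directed_path :: "('v, 'u, 'w, 'b) scm \<Rightarrow> 'v list \<Rightarrow> bool" where
  "directed_path M \<pi> \<longleftrightarrow> \<pi> \<noteq> [] \<and> set \<pi> \<subseteq> endo M \<and>
     (\<forall>i. Suc i < length \<pi> \<longrightarrow> \<pi> ! i \<in> parents M (\<pi> ! Suc i))"

text \<open>
  \<open>propagate M \<omega> k a \<rho>\<close> changes the value of \<open>k\<close> to \<open>a\<close> as input of the first variable
  of \<open>\<rho>\<close> only, and carries the resulting value on along \<open>\<rho>\<close>. All other inputs of the mechanisms
  keep their natural values, e.g. for \<open>[X, W, Y]\<close> the result is \<open>Y(W(x), X)\<close>.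
\<close>

primrec propagate ::
  "('v, 'u, 'w, 'b) scm \<Rightarrow> 'w \<Rightarrow> 'v \<Rightarrow> real \<Rightarrow> 'v list \<Rightarrow> real" where
  "propagate M \<omega> k a [] = a"
| "propagate M \<omega> k a (j # \<rho>) =
     propagate M \<omega> j
       (mech M j (restrict ((endo_val M \<omega>)(k := a)) (parents M j)) (exo_vec M j \<omega>)) \<rho>"

definition path_counterfactual ::
  "('v, 'u, 'w, 'b) scm \<Rightarrow> 'v list \<Rightarrow> real \<Rightarrow> 'w \<Rightarrow> real" where
  "path_counterfactual M \<pi> x \<omega> = propagate M \<omega> (hd \<pi>) x (tl \<pi>)"


section \<open>Conditional expectations\<close>

definition sigma_gen :: "('v, 'u, 'w, 'b) scm \<Rightarrow> 'v set \<Rightarrow> 'w measure" where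
  "sigma_gen M A =
     vimage_algebra (space (sample M)) (\<lambda>\<omega>. restrict (endo_val M \<omega>) A) (PiM A (\<lambda>_. borel))"

text \<open>The variable \<open>k\<close>, with the values of the variables \<open>A\<close> in its mechanism replaced by \<open>p\<close>.\<close>

definition plug_in ::
  "('v, 'u, 'w, 'b) scm \<Rightarrow> 'v \<Rightarrow> 'v set \<Rightarrow> ('v \<Rightarrow> real) \<Rightarrow> 'w \<Rightarrow> real" where
  "plug_in M k A p \<omega> =
     mech M k (restrict (override_on (endo_val M \<omega>) p A) (parents M k)) (exo_vec M k \<omega>)"

definition near_event ::
  "('v, 'u, 'w, 'b) scm \<Rightarrow> 'v set \<Rightarrow> ('v \<Rightarrow> real) \<Rightarrow> real \<Rightarrow> 'w set" where
  "near_event M A p r = {\<omega> \<in> space (sample M). \<forall>j\<in>A. \<bar>endo_val M \<omega> j - p j\<bar> < r}"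

text \<open>
  Elementary conditional expectation of \<open>plug_in M k A p\<close> given \<open>near_event M A p r\<close>. A null
  event carries no information, and the unconditional expectation is taken.
\<close>

definition cond_exp_near ::
  "('v, 'u, 'w, 'b) scm \<Rightarrow> 'v \<Rightarrow> 'v set \<Rightarrow> ('v \<Rightarrow> real) \<Rightarrow> real \<Rightarrow> real" where
  "cond_exp_near M k A p r =
     (let B = near_event M A p r in
      if measure (sample M) B = 0 then (\<integral>\<omega>. plug_in M k A p \<omega> \<partial>sample M)
      else (\<integral>\<omega>. indicator B \<omega> * plug_in M k A p \<omega> \<partial>sample M) / measure (sample M) B)"

text \<open>
  \<open>m\<close> is the function \<open>p \<mapsto> E[V\<^sub>k | V\<^sub>A = p]\<close>. The first three conjuncts say that \<open>m\<close> is a version of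
  the conditional expectation. They determine \<open>m\<close> only up to null sets of the law of \<open>V\<^sub>A\<close>, whereas
  parity of derivatives is a condition at every \<open>p\<close>. The last conjunct therefore fixes the
  version: \<open>m p\<close> is the limit of the conditional expectations, given that \<open>V\<^sub>A\<close> is close to \<open>p\<close>, of
  the mechanism of \<open>k\<close> with \<open>V\<^sub>A\<close> set to \<open>p\<close>. In particular, \<open>m = f\<^sub>k\<close> everywhere if \<open>V\<^sub>k\<close> is a
  deterministic function \<open>f\<^sub>k\<close> of \<open>V\<^sub>A\<close>.
\<close>

definition is_cond_exp_fun ::
  "('v, 'u, 'w, 'b) scm \<Rightarrow> 'v \<Rightarrow> 'v set \<Rightarrow> (('v \<Rightarrow> real) \<Rightarrow> real) \<Rightarrow> bool" where
  "is_cond_exp_fun M k A m \<longleftrightarrow>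
     integrable (sample M) (\<lambda>\<omega>. endo_val M \<omega> k) \<and>
     m \<in> borel_measurable (PiM A (\<lambda>_. borel)) \<and>
     (AE \<omega> in sample M.
        real_cond_exp (sample M) (sigma_gen M A) (\<lambda>\<omega>. endo_val M \<omega> k) \<omega>
          = m (restrict (endo_val M \<omega>) A)) \<and>
     (\<forall>p \<in> A \<rightarrow>\<^sub>E UNIV. integrable (sample M) (plug_in M k A p) \<and>
        ((\<lambda>r. cond_exp_near M k A p r) \<longlongrightarrow> m p) (at_right 0))"


section \<open>Differentiability of functions of finitely many named real variables\<close>

text \<open>Frechet differentiability on the extensional functions \<open>A \<rightarrow>\<^sub>E UNIV\<close>, i.e. on \<open>\<real>\<^sup>A\<close>.\<close>

definition differentiable_in_vars :: "'v set \<Rightarrow> (('v \<Rightarrow> real) \<Rightarrow> real) \<Rightarrow> bool" where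
  "differentiable_in_vars A m \<longleftrightarrow>
     (\<forall>p \<in> A \<rightarrow>\<^sub>E UNIV. \<exists>g :: 'v \<Rightarrow> real. \<forall>e>0. \<exists>d>0. \<forall>q \<in> A \<rightarrow>\<^sub>E UNIV.
        (\<Sum>j\<in>A. \<bar>q j - p j\<bar>) < d \<longrightarrow>
        \<bar>m q - m p - (\<Sum>j\<in>A. g j * (q j - p j))\<bar> \<le> e * (\<Sum>j\<in>A. \<bar>q j - p j\<bar>))"

definition partial_deriv :: "'v \<Rightarrow> (('v \<Rightarrow> real) \<Rightarrow> real) \<Rightarrow> ('v \<Rightarrow> real) \<Rightarrow> real" where
  "partial_deriv j m p = deriv (\<lambda>t. m (p(j := t))) (p j)"


section \<open>Corresponding models and the two parity notions\<close>

definition corresponding ::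
  "('v, 'u, 'w, 'b) scm \<Rightarrow> ('v, 'u, 'w, 'b) scm \<Rightarrow> ('v \<Rightarrow> 'v) \<Rightarrow> bool" where
  "corresponding M Mt c \<longleftrightarrow> sample Mt = sample M \<and> bij_betw c (endo M) (endo Mt)"

text \<open>Equivalent variables are the same variable, with the same inputs and the same mechanism.\<close>

definition equivalent_var ::
  "('v, 'u, 'w, 'b) scm \<Rightarrow> ('v, 'u, 'w, 'b) scm \<Rightarrow> ('v \<Rightarrow> 'v) \<Rightarrow> 'v \<Rightarrow> bool" where
  "equivalent_var M Mt c k \<longleftrightarrow>
     c k = k \<and> parents Mt k = parents M k \<and> exo_of Mt k = exo_of M k \<and> mech Mt k = mech M k \<and>
     (\<forall>u\<in>exo_of M k. exo_space Mt u = exo_space M u \<and> exo_var Mt u = exo_var M u)"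

text \<open>
  The generated \<open>c Y\<close> is a new variable. As \<open>Y\<close> itself does not occur in \<open>Mt\<close>, it cannot be a
  parent of any equivalent variable.
\<close>

definition only_generated ::
  "('v, 'u, 'w, 'b) scm \<Rightarrow> ('v, 'u, 'w, 'b) scm \<Rightarrow> ('v \<Rightarrow> 'v) \<Rightarrow> 'v \<Rightarrow> bool" where
  "only_generated M Mt c Y \<longleftrightarrow>
     c Y \<notin> endo M \<and> (\<forall>k \<in> endo M - {Y}. equivalent_var M Mt c k) \<and>
     exo Mt = (exo M - exo_of M Y) \<union> exo_of Mt (c Y)"

text \<open>
  In \<open>Mt\<close> the conditioning set is the image of the parents in \<open>M\<close>, which in general is
  not the parent set of the corresponding variable.
\<close>

definition predictive_parity_in_derivatives ::
  "('v, 'u, 'w, 'b) scm \<Rightarrow> ('v, 'u, 'w, 'b) scm \<Rightarrow> ('v \<Rightarrow> 'v) \<Rightarrow> 'v list \<Rightarrow> bool" where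
  "predictive_parity_in_derivatives M Mt c \<pi> \<longleftrightarrow>
     (\<forall>i. Suc i < length \<pi> \<longrightarrow>
       (let j = \<pi> ! i; k = \<pi> ! Suc i; A = parents M k in
        \<exists>m mt. is_cond_exp_fun M k A m \<and> is_cond_exp_fun Mt (c k) (c ` A) mt \<and>
          differentiable_in_vars A m \<and> differentiable_in_vars (c ` A) mt \<and>
          (\<forall>p \<in> c ` A \<rightarrow>\<^sub>E UNIV.
             partial_deriv (c j) mt p = partial_deriv j m (\<lambda>a\<in>A. p (c a)))))"

definition causal_predictive_parity ::
  "('v, 'u, 'w, 'b) scm \<Rightarrow> ('v, 'u, 'w, 'b) scm \<Rightarrow> ('v \<Rightarrow> 'v) \<Rightarrow> 'v list \<Rightarrow>
   real \<Rightarrow> real \<Rightarrow> 'v set \<Rightarrow> bool" where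
  "causal_predictive_parity M Mt c \<pi> x\<^sub>0 x\<^sub>1 Z \<longleftrightarrow>
     (AE \<omega> in sample M.
        real_cond_exp (sample M) (sigma_gen M Z) (path_counterfactual M \<pi> x\<^sub>1) \<omega>
        - real_cond_exp (sample M) (sigma_gen M Z) (path_counterfactual M \<pi> x\<^sub>0) \<omega>
        = real_cond_exp (sample Mt) (sigma_gen M Z) (path_counterfactual Mt (map c \<pi>) x\<^sub>1) \<omega>
        - real_cond_exp (sample Mt) (sigma_gen M Z) (path_counterfactual Mt (map c \<pi>) x\<^sub>0) \<omega>)"

end

theory Submission
  imports Defs
begin

text \<open>
  As the generated variable is new and all other variables are unchanged, \<open>Y\<close> has no children.
  Hence its parents \<open>A\<close> and the value \<open>w x\<close> that \<open>X = x\<close> produces at \<open>W\<close> along the path are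
  functions of the background variables other than \<open>U\<^sub>Y\<close>, agree in the two models, and are
  independent of \<open>U\<^sub>Y\<close>. By independence the regression function is \<open>m p = E[f\<^sub>Y(p, U\<^sub>Y)]\<close>, and
  integrating \<open>U\<^sub>Y\<close> out first gives \<open>E[Y(\<pi>(x)) | A] = E[m(A with W := w x) | A]\<close>. For the
  prediction, \<open>mt\<close> is its mechanism itself. Parity of derivatives makes \<open>m - mt\<close> constant in the
  coordinate \<open>W\<close>, so that \<open>E[Y(\<pi>(x)) | A]\<close> and its prediction differ by \<open>E[(m - mt)(A) | A]\<close>,
  which does not depend on \<open>x\<close>.
\<close>

section \<open>Partial derivatives\<close>

text \<open>Moving coordinate \<open>j\<close> alone collapses both sums over \<open>A\<close> to
  their \<open>j\<close>-th term, so the Frechet expansion at \<open>p\<close> becomes an ordinary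
  one-variable derivative with slope \<open>g j\<close>, which is then the value of
  \<open>deriv\<close>.\<close>

lemma differentiable_in_vars_partial:
  assumes m: "differentiable_in_vars A m" and A: "finite A" "j \<in> A" and p: "p \<in> A \<rightarrow>\<^sub>E UNIV"
  shows "((\<lambda>t. m (p(j := t))) has_real_derivative partial_deriv j m p) (at (p j))"
proof -
  from m p obtain g :: "_ \<Rightarrow> real" where g: "\<And>e. e > 0 \<Longrightarrow> \<exists>d>0. \<forall>q \<in> A \<rightarrow>\<^sub>E UNIV.
        (\<Sum>i\<in>A. \<bar>q i - p i\<bar>) < d \<longrightarrow>
        \<bar>m q - m p - (\<Sum>i\<in>A. g i * (q i - p i))\<bar> \<le> e * (\<Sum>i\<in>A. \<bar>q i - p i\<bar>)"
    unfolding differentiable_in_vars_def by blast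
  have abs_sum: "(\<Sum>i\<in>A. \<bar>(p(j := t)) i - p i\<bar>) = \<bar>t - p j\<bar>" for t
    using A by (subst sum.remove[of _ j]) auto
  have lin_sum: "(\<Sum>i\<in>A. g i * ((p(j := t)) i - p i)) = g j * (t - p j)" for t
    using A by (subst sum.remove[of _ j]) auto
  have ext: "p(j := t) \<in> A \<rightarrow>\<^sub>E UNIV" for t
    using p A by (auto simp: PiE_iff extensional_def)
  have "((\<lambda>t. m (p(j := t))) has_derivative (*) (g j)) (at (p j))"
    unfolding has_derivative_at_alt
  proof (intro conjI allI impI)
    fix e :: real assume "e > 0"
    from g[OF this] obtain d where d: "d > 0" and *: "\<And>q. q \<in> A \<rightarrow>\<^sub>E UNIV \<Longrightarrow>
        (\<Sum>i\<in>A. \<bar>q i - p i\<bar>) < d \<Longrightarrow>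
        \<bar>m q - m p - (\<Sum>i\<in>A. g i * (q i - p i))\<bar> \<le> e * (\<Sum>i\<in>A. \<bar>q i - p i\<bar>)"
      by blast
    show "\<exists>d>0. \<forall>y. norm (y - p j) < d \<longrightarrow>
        norm (m (p(j := y)) - m (p(j := p j)) - g j * (y - p j)) \<le> e * norm (y - p j)"
      using d *[OF ext] unfolding abs_sum lin_sum by auto
  qed (rule bounded_linear_mult_right)
  then have "((\<lambda>t. m (p(j := t))) has_real_derivative g j) (at (p j))"
    by (simp add: has_field_derivative_def)
  then show ?thesis
    unfolding partial_deriv_def by (simp add: DERIV_imp_deriv)
qed

text \<open>Along the line through \<open>p\<close> in direction \<open>j\<close> the difference
  \<open>m - n\<close> has derivative 0: for each \<open>s\<close>, the point
  \<open>p(j := s)\<close> serves as base point, so equality of the partial derivatives is used on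
  the entire line. A function with zero derivative on all of the reals is constant.\<close>

lemma partial_deriv_eq_imp_diff_const:
  assumes A: "finite A" "j \<in> A"
    and m: "differentiable_in_vars A m" and n: "differentiable_in_vars A n"
    and eq: "\<And>p. p \<in> A \<rightarrow>\<^sub>E UNIV \<Longrightarrow> partial_deriv j n p = partial_deriv j m p"
    and p: "p \<in> A \<rightarrow>\<^sub>E UNIV"
  shows "m (p(j := t)) - n (p(j := t)) = m p - n p"
proof -
  have "((\<lambda>t. m (p(j := t)) - n (p(j := t))) has_real_derivative 0) (at s)" for s
  proof -
    have ext: "p(j := s) \<in> A \<rightarrow>\<^sub>E UNIV"
      using p A by (auto simp: PiE_iff extensional_def)
    show ?thesis
      using DERIV_diff[OF differentiable_in_vars_partial[OF m A ext]
          differentiable_in_vars_partial[OF n A ext]] eq[OF ext] by simp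
  qed
  then have "m (p(j := t)) - n (p(j := t)) = m (p(j := p j)) - n (p(j := p j))"
    by (intro DERIV_isconst_all) blast
  then show ?thesis by simp
qed

section \<open>Conditioning in the presence of independent noise\<close>

lemma subalgebra_trans: "subalgebra M F \<Longrightarrow> subalgebra F G \<Longrightarrow> subalgebra M G"
  unfolding subalgebra_def by auto

text \<open>\<open>U\<close> can be integrated out first, since \<open>\<omega>\<close>, read as a random element of the coarser
  space \<open>F\<close>, is independent of it. (\<^const>\<open>prob_space.indep_var\<close> is unusable here, as it wants both
  variables to have the same type.)\<close>

lemma (in prob_space) integral_freeze:
  fixes f :: "'a \<times> 'c \<Rightarrow> real" and F :: "'a measure" and L :: "'c measure"
  assumes F: "subalgebra M F" and U[measurable]: "U \<in> measurable M L"
    and indep: "indep_set (sets F) {U -` B \<inter> space M |B. B \<in> sets L}"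
    and f[measurable]: "f \<in> borel_measurable (F \<Otimes>\<^sub>M L)"
    and int: "integrable M (\<lambda>\<omega>. f (\<omega>, U \<omega>))" and A[measurable]: "A \<in> sets F"
  shows "integrable M (\<lambda>\<omega>. indicator A \<omega> * (\<integral>\<omega>'. f (\<omega>, U \<omega>') \<partial>M))"
    and "(\<integral>\<omega>. indicator A \<omega> * f (\<omega>, U \<omega>) \<partial>M)
      = (\<integral>\<omega>. indicator A \<omega> * (\<integral>\<omega>'. f (\<omega>, U \<omega>') \<partial>M) \<partial>M)"
proof -
  have [measurable]: "(\<lambda>\<omega>. \<omega>) \<in> measurable M F"
    by (rule measurable_from_subalg[OF F]) simp
  have space_F: "space F = space M" and sets_F: "sets F \<subseteq> sets M"
    using F by (simp_all add: subalgebra_def)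
  define P where "P = distr M F (\<lambda>\<omega>. \<omega>)"
  define Q where "Q = distr M L U"
  interpret P: prob_space P unfolding P_def by (rule prob_space_distr) simp
  interpret Q: prob_space Q unfolding Q_def by (rule prob_space_distr) simp
  interpret PQ: pair_prob_space P Q ..
  have sets_P[measurable_cong]: "sets P = sets F" and sets_Q[measurable_cong]: "sets Q = sets L"
    by (simp_all add: P_def Q_def)
  \<comment> \<open>Independence is multiplicativity on rectangles, so the pair of
    \<open>\<omega>\<close>, read in \<open>F\<close>, and \<open>U\<close> has the product law
    \<open>P \<Otimes>\<^sub>M Q\<close>. This makes Fubini applicable.\<close>
  have joint: "P \<Otimes>\<^sub>M Q = distr M (F \<Otimes>\<^sub>M L) (\<lambda>\<omega>. (\<omega>, U \<omega>))"
  proof (rule pair_measure_eqI)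
    fix A B assume "A \<in> sets P" "B \<in> sets Q"
    then have AB[measurable]: "A \<in> sets F" "B \<in> sets L" by (simp_all add: sets_P sets_Q)
    have "emeasure (distr M (F \<Otimes>\<^sub>M L) (\<lambda>\<omega>. (\<omega>, U \<omega>))) (A \<times> B)
        = emeasure M ((\<lambda>\<omega>. (\<omega>, U \<omega>)) -` (A \<times> B) \<inter> space M)"
      by (subst emeasure_distr) auto
    also have "(\<lambda>\<omega>. (\<omega>, U \<omega>)) -` (A \<times> B) \<inter> space M = A \<inter> (U -` B \<inter> space M)"
      by auto
    also have "emeasure M \<dots> = emeasure M A * emeasure M (U -` B \<inter> space M)"
    proof -
      have "prob (A \<inter> (U -` B \<inter> space M)) = prob A * prob (U -` B \<inter> space M)"
        by (rule indep_setD[OF indep AB(1)]) (use AB(2) in blast)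
      then show ?thesis by (simp add: emeasure_eq_measure ennreal_mult)
    qed
    also have "\<dots> = emeasure P A * emeasure Q B"
      using sets.sets_into_space[OF AB(1)]
      by (simp add: P_def Q_def emeasure_distr space_F Int_absorb2)
    finally show "emeasure P A * emeasure Q B = emeasure (distr M (F \<Otimes>\<^sub>M L) (\<lambda>\<omega>. (\<omega>, U \<omega>))) (A \<times> B)" ..
  qed (simp_all add: sets_P sets_Q P.sigma_finite_measure_axioms Q.sigma_finite_measure_axioms
      cong: sets_pair_measure_cong)
  let ?g = "\<lambda>\<omega>. \<integral>\<omega>'. f (\<omega>, U \<omega>') \<partial>M"
  let ?f = "\<lambda>(\<omega>, y). indicator A \<omega> * f (\<omega>, y)"
  have Q_int: "(\<integral>y. f (\<omega>, y) \<partial>Q) = ?g \<omega>" if "\<omega> \<in> space M" for \<omega>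
    using that unfolding Q_def by (subst integral_distr) (auto simp: space_F)
  have "integrable M (\<lambda>\<omega>. indicator A \<omega> * f (\<omega>, U \<omega>))"
    using integrable_mult_indicator[OF subsetD[OF sets_F A] int] by simp
  then have PQ_int: "integrable (P \<Otimes>\<^sub>M Q) ?f"
    unfolding joint by (subst integrable_distr_eq) auto
  have inner: "(\<integral>y. ?f (\<omega>, y) \<partial>Q) = indicator A \<omega> * ?g \<omega>" if "\<omega> \<in> space M" for \<omega>
    using Q_int[OF that] by simp
  have "integrable P (\<lambda>\<omega>. \<integral>y. ?f (\<omega>, y) \<partial>Q)"
    by (rule PQ.integrable_fst'[OF PQ_int])
  then have "integrable M (\<lambda>\<omega>. \<integral>y. ?f (\<omega>, y) \<partial>Q)"
    unfolding P_def by (rule integrable_distr[rotated]) simp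
  then show "integrable M (\<lambda>\<omega>. indicator A \<omega> * ?g \<omega>)"
    by (subst (asm) Bochner_Integration.integrable_cong[OF refl inner]) auto
  have "(\<integral>\<omega>. indicator A \<omega> * f (\<omega>, U \<omega>) \<partial>M) = (\<integral>z. ?f z \<partial>(P \<Otimes>\<^sub>M Q))"
    unfolding joint by (subst integral_distr) auto
  also have "\<dots> = (\<integral>\<omega>. \<integral>y. ?f (\<omega>, y) \<partial>Q \<partial>P)"
    by (rule PQ.integral_fst'[OF PQ_int, symmetric])
  also have "\<dots> = (\<integral>\<omega>. \<integral>y. ?f (\<omega>, y) \<partial>Q \<partial>M)"
    by (subst (1) P_def, subst integral_distr) measurable
  also have "\<dots> = (\<integral>\<omega>. indicator A \<omega> * ?g \<omega> \<partial>M)"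
    by (intro Bochner_Integration.integral_cong inner refl)
  finally show "(\<integral>\<omega>. indicator A \<omega> * f (\<omega>, U \<omega>) \<partial>M) = (\<integral>\<omega>. indicator A \<omega> * ?g \<omega> \<partial>M)" .
qed

text \<open>Every set of \<open>G\<close> lies in \<open>F\<close>, so freezing gives
  \<open>f (\<omega>, U \<omega>)\<close> and its average over \<open>U\<close> the same integral
  over each set of \<open>G\<close>; this characterizes the conditional expectation. The average is
  a function on \<open>F\<close> and may fail to be \<open>G\<close>-measurable, hence the
  conditional expectation on the right as well.\<close>

lemma (in prob_space) real_cond_exp_freeze:
  fixes f :: "'a \<times> 'c \<Rightarrow> real" and F :: "'a measure" and L :: "'c measure"
  assumes F: "subalgebra M F" and G: "subalgebra F G" and U: "U \<in> measurable M L"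
    and indep: "indep_set (sets F) {U -` B \<inter> space M |B. B \<in> sets L}"
    and f: "f \<in> borel_measurable (F \<Otimes>\<^sub>M L)"
    and int: "integrable M (\<lambda>\<omega>. f (\<omega>, U \<omega>))"
  shows "integrable M (\<lambda>\<omega>. \<integral>\<omega>'. f (\<omega>, U \<omega>') \<partial>M)" (is "integrable M ?g")
    and "AE \<omega> in M. real_cond_exp M G (\<lambda>\<omega>. f (\<omega>, U \<omega>)) \<omega>
      = real_cond_exp M G (\<lambda>\<omega>. \<integral>\<omega>'. f (\<omega>, U \<omega>') \<partial>M) \<omega>"
proof -
  note freeze = integral_freeze[OF F U indep f int]
  have "space F = space M"
    using F by (simp add: subalgebra_def)
  then show int_g: "integrable M ?g"
    using freeze(1)[OF sets.top]
    by (subst (asm) Bochner_Integration.integrable_cong[where g = ?g]) auto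
  interpret G: finite_measure_subalgebra M G
    by unfold_locales (rule subalgebra_trans[OF F G])
  show "AE \<omega> in M. real_cond_exp M G (\<lambda>\<omega>. f (\<omega>, U \<omega>)) \<omega> = real_cond_exp M G ?g \<omega>"
  proof (rule G.real_cond_exp_charact)
    fix A assume A: "A \<in> sets G"
    then have "A \<in> sets F" using G by (auto simp: subalgebra_def)
    then have "(\<integral>\<omega>\<in>A. f (\<omega>, U \<omega>) \<partial>M) = (\<integral>\<omega>\<in>A. ?g \<omega> \<partial>M)"
      using freeze(2) unfolding set_lebesgue_integral_def by simp
    also have "\<dots> = (\<integral>\<omega>\<in>A. real_cond_exp M G ?g \<omega> \<partial>M)"
      by (rule G.real_cond_exp_intA[OF int_g A])
    finally show "(\<integral>\<omega>\<in>A. f (\<omega>, U \<omega>) \<partial>M) = (\<integral>\<omega>\<in>A. real_cond_exp M G ?g \<omega> \<partial>M)" .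
  qed (use int int_g in auto)
qed

section \<open>A variable without children\<close>

text \<open>The recursion peels variables off the front, whereas the argument about \<open>Y\<close>
  concerns the last step. Writing \<open>last (k # \<rho>)\<close> covers the empty
  \<open>\<rho>\<close>, where the changed variable \<open>k\<close> feeds \<open>j\<close>
  directly.\<close>

lemma propagate_snoc:
  "propagate M \<omega> k a (\<rho> @ [j]) =
     mech M j (restrict ((endo_val M \<omega>)(last (k # \<rho>) := propagate M \<omega> k a \<rho>)) (parents M j))
       (exo_vec M j \<omega>)"
  by (induction \<rho> arbitrary: k a) auto

text \<open>The information in all noise except that of \<open>Y\<close>. It is generated by the
  vectors \<open>exo_vec M k\<close> themselves, so that their mutual independence transfers
  directly; it plays the part of \<open>F\<close> in the freezing lemmas.\<close>

definition sigma_others :: "('v, 'u, 'w, 'b) scm \<Rightarrow> 'v \<Rightarrow> 'w measure" where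
  "sigma_others M Y = vimage_algebra (space (sample M)) (\<lambda>\<omega>. \<lambda>k\<in>endo M - {Y}. exo_vec M k \<omega>)
     (PiM (endo M - {Y}) (\<lambda>k. PiM (exo_of M k) (exo_space M)))"

definition sink :: "('v, 'u, 'w, 'b) scm \<Rightarrow> 'v \<Rightarrow> bool" where
  "sink M Y \<longleftrightarrow> Y \<in> endo M \<and> (\<forall>k\<in>endo M. Y \<notin> parents M k)"

context structural_causal_model
begin

lemma exo_in_space:
  "\<omega> \<in> space (sample M) \<Longrightarrow> (\<lambda>u\<in>exo M. exo_var M u \<omega>) \<in> space (PiM (exo M) (exo_space M))"
  using measurable_space[OF exo_var_measurable] by (auto simp: space_PiM)

lemma exo_vec_measurable:
  "k \<in> endo M \<Longrightarrow> exo_vec M k \<in> measurable (sample M) (PiM (exo_of M k) (exo_space M))"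
  unfolding exo_vec_def using exo_of_subset by (intro measurable_restrict exo_var_measurable) auto

lemma restrict_exo_var:
  "k \<in> endo M \<Longrightarrow> restrict (\<lambda>u\<in>exo M. exo_var M u \<omega>) (exo_of M k) = exo_vec M k \<omega>"
  using exo_of_subset[of k] by (auto simp: exo_vec_def fun_eq_iff restrict_def)

lemma solves_solution:
  "u \<in> space (PiM (exo M) (exo_space M)) \<Longrightarrow> solves M u (solution M u)"
  unfolding solution_def by (rule theI'[OF unique_solution])

lemma endo_val_eq_mech:
  assumes "\<omega> \<in> space (sample M)" "k \<in> endo M"
  shows "endo_val M \<omega> k = mech M k (restrict (endo_val M \<omega>) (parents M k)) (exo_vec M k \<omega>)"
  using solves_solution[OF exo_in_space[OF assms(1)]] restrict_exo_var[OF assms(2)] assms(2)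
  unfolding endo_val_def solves_def by metis

text \<open>A sink can always be appended to a solution of the other equations, which is therefore
  unique as well.\<close>

lemma solution_eqI:
  assumes Y: "sink M Y" and u: "u \<in> space (PiM (exo M) (exo_space M))"
    and v: "\<And>k. k \<in> endo M - {Y} \<Longrightarrow>
      v k = mech M k (restrict v (parents M k)) (restrict u (exo_of M k))"
    and k: "k \<in> endo M - {Y}"
  shows "solution M u k = v k"
proof -
  define y where "y = mech M Y (restrict v (parents M Y)) (restrict u (exo_of M Y))"
  define v' where "v' = restrict (v(Y := y)) (endo M)"
  \<comment> \<open>No mechanism reads the sink, so overwriting its value leaves all inputs
    unchanged, including those of the mechanism of \<open>Y\<close>.\<close>
  have par: "restrict v' (parents M i) = restrict v (parents M i)" if "i \<in> endo M" for i
    using that Y parents_subset[OF that] by (auto simp: v'_def sink_def fun_eq_iff restrict_def)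
  have "solves M u v'"
    unfolding solves_def
  proof (intro conjI ballI)
    fix i assume i: "i \<in> endo M"
    show "v' i = mech M i (restrict v' (parents M i)) (restrict u (exo_of M i))"
      unfolding par[OF i] using i v[of i] by (auto simp: v'_def y_def)
  qed (simp add: v'_def)
  then have "solution M u = v'"
    using unique_solution[OF u] solves_solution[OF u] by blast
  then show ?thesis using k by (simp add: v'_def)
qed

text \<open>This serves two purposes: \<open>v\<close> is taken once from a solution with the
  remaining noise held fixed, to obtain measurability, and once from the solution of the other
  model, to compare the two.\<close>

lemma endo_val_eqI:
  assumes "sink M Y" "\<omega> \<in> space (sample M)"
    and v: "\<And>k. k \<in> endo M - {Y} \<Longrightarrow> v k = mech M k (restrict v (parents M k)) (exo_vec M k \<omega>)"
    and "k \<in> endo M - {Y}"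
  shows "endo_val M \<omega> k = v k"
  unfolding endo_val_def
proof (rule solution_eqI[OF assms(1) exo_in_space[OF assms(2)] _ assms(4)])
  fix k assume k: "k \<in> endo M - {Y}"
  then show "v k = mech M k (restrict v (parents M k))
      (restrict (\<lambda>u\<in>exo M. exo_var M u \<omega>) (exo_of M k))"
    using v[OF k] restrict_exo_var[of k] by simp
qed

lemma subalgebra_sigma_others: "subalgebra (sample M) (sigma_others M Y)"
  unfolding subalgebra_def sigma_others_def
  by (intro conjI sets_image_in_sets measurable_restrict exo_vec_measurable) auto

lemma space_sigma_others[simp]: "space (sigma_others M Y) = space (sample M)"
  by (simp add: sigma_others_def)

lemma exo_vec_measurable_others:
  assumes "k \<in> endo M - {Y}"
  shows "exo_vec M k \<in> measurable (sigma_others M Y) (PiM (exo_of M k) (exo_space M))"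
proof -
  have "(\<lambda>\<omega>. \<lambda>k\<in>endo M - {Y}. exo_vec M k \<omega>) \<in> measurable (sigma_others M Y)
      (PiM (endo M - {Y}) (\<lambda>k. PiM (exo_of M k) (exo_space M)))"
    unfolding sigma_others_def
    by (rule measurable_vimage_algebra1)
       (use measurable_space[OF exo_vec_measurable] in \<open>auto simp: space_PiM\<close>)
  from measurable_compose[OF this measurable_component_singleton[OF assms]]
  show ?thesis using assms by (simp cong: measurable_cong)
qed

text \<open>The solution map takes all background variables as input, including those read by
  \<open>Y\<close> alone. Holding the latter fixed alters no equation except that of
  \<open>Y\<close>, so the value at \<open>k\<close> stays the same and becomes a function of the
  other noise.\<close>

lemma endo_val_measurable_others:
  assumes Y: "sink M Y" and k: "k \<in> endo M - {Y}"
  shows "(\<lambda>\<omega>. endo_val M \<omega> k) \<in> borel_measurable (sigma_others M Y)"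
proof -
  obtain \<omega>0 where \<omega>0: "\<omega>0 \<in> space (sample M)"
    using not_empty by blast
  define E where "E = (\<Union>k\<in>endo M - {Y}. exo_of M k)"
  \<comment> \<open>Variables in \<open>E\<close> enter some mechanism other than that of
    \<open>Y\<close> and keep their value; all others are frozen at the arbitrary sample point
    \<open>\<omega>0\<close>.\<close>
  define H where "H \<omega> = (\<lambda>u\<in>exo M. exo_var M u (if u \<in> E then \<omega> else \<omega>0))" for \<omega>
  have H: "H \<in> measurable (sigma_others M Y) (PiM (exo M) (exo_space M))"
    unfolding H_def
  proof (rule measurable_restrict)
    fix u assume u: "u \<in> exo M"
    show "(\<lambda>\<omega>. exo_var M u (if u \<in> E then \<omega> else \<omega>0)) \<in> measurable (sigma_others M Y) (exo_space M u)"
    proof (cases "u \<in> E")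
      case True
      then obtain i where i: "i \<in> endo M - {Y}" and ui: "u \<in> exo_of M i"
        by (auto simp: E_def)
      have "(\<lambda>\<omega>. exo_vec M i \<omega> u) \<in> measurable (sigma_others M Y) (exo_space M u)"
        by (rule measurable_compose[OF exo_vec_measurable_others[OF i]
              measurable_component_singleton[OF ui]])
      then show ?thesis using True ui by (simp add: exo_vec_def)
    next
      case False
      then show ?thesis
        using measurable_space[OF exo_var_measurable[OF u] \<omega>0] by simp
    qed
  qed
  have "endo_val M \<omega> k = solution M (H \<omega>) k" if \<omega>: "\<omega> \<in> space (sample M)" for \<omega>
  proof (rule endo_val_eqI[OF Y \<omega> _ k])
    fix i assume i: "i \<in> endo M - {Y}"
    have "restrict (H \<omega>) (exo_of M i) = exo_vec M i \<omega>"
      using i exo_of_subset[of i] by (auto simp: H_def exo_vec_def E_def fun_eq_iff restrict_def)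
    moreover have "solves M (H \<omega>) (solution M (H \<omega>))"
      using measurable_space[OF H] \<omega> by (intro solves_solution) simp
    ultimately show "solution M (H \<omega>) i =
        mech M i (restrict (solution M (H \<omega>)) (parents M i)) (exo_vec M i \<omega>)"
      using i unfolding solves_def by (metis DiffD1)
  qed
  moreover have "(\<lambda>\<omega>. solution M (H \<omega>) k) \<in> borel_measurable (sigma_others M Y)"
    using k by (intro measurable_compose[OF H solution_measurable]) auto
  ultimately show ?thesis
    by (subst measurable_cong[where g = "\<lambda>\<omega>. solution M (H \<omega>) k"]) auto
qed

lemma modified_endo_val_measurable:
  assumes Y: "sink M Y" and j: "j \<in> endo M" and a: "a \<in> borel_measurable (sigma_others M Y)"
  shows "(\<lambda>\<omega>. restrict ((endo_val M \<omega>)(k := a \<omega>)) (parents M j))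
    \<in> measurable (sigma_others M Y) (PiM (parents M j) (\<lambda>_. borel))"
proof (rule measurable_restrict)
  fix i assume "i \<in> parents M j"
  then have "i \<in> endo M - {Y}"
    using Y parents_subset[OF j] j by (auto simp: sink_def)
  then show "(\<lambda>\<omega>. ((endo_val M \<omega>)(k := a \<omega>)) i) \<in> borel_measurable (sigma_others M Y)"
    using a endo_val_measurable_others[OF Y] by (cases "i = k") auto
qed

text \<open>The starting value is a random variable \<open>a\<close> rather than a constant, because
  after one step along the path the carried value depends on the sample point.\<close>

lemma propagate_measurable_others:
  assumes Y: "sink M Y" and "a \<in> borel_measurable (sigma_others M Y)"
    and "set \<rho> \<subseteq> endo M - {Y}"
  shows "(\<lambda>\<omega>. propagate M \<omega> k (a \<omega>) \<rho>) \<in> borel_measurable (sigma_others M Y)"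
  using assms(2,3)
proof (induction \<rho> arbitrary: k a)
  case (Cons j \<rho>)
  from Cons.prems have j: "j \<in> endo M - {Y}" by simp
  have "(\<lambda>\<omega>. mech M j (restrict ((endo_val M \<omega>)(k := a \<omega>)) (parents M j)) (exo_vec M j \<omega>))
      \<in> borel_measurable (sigma_others M Y)"
    using measurable_compose[OF measurable_Pair[OF
          modified_endo_val_measurable[OF Y _ Cons.prems(1)] exo_vec_measurable_others[OF j]]
        mech_measurable] j by simp
  from Cons.IH[OF this] Cons.prems show ?case by simp
qed simp

text \<open>Mutual independence survives grouping into the two blocks \<open>endo M - {Y}\<close>
  and \<open>{Y}\<close>. The first block generates \<open>sigma_others M Y\<close>.\<close>

lemma indep_sigma_others:
  assumes ind: "independent_exo M" and Y: "Y \<in> endo M"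
  shows "indep_set (sets (sigma_others M Y))
    {exo_vec M Y -` B \<inter> space (sample M) |B. B \<in> sets (PiM (exo_of M Y) (exo_space M))}"
proof -
  let ?N = "\<lambda>k. PiM (exo_of M k) (exo_space M)"
  let ?R = "\<lambda>K \<omega>. \<lambda>k\<in>K. exo_vec M k \<omega>"
  have "indep_var (PiM (endo M - {Y}) ?N) (?R (endo M - {Y})) (PiM {Y} ?N) (?R {Y})"
    using ind Y unfolding independent_exo_def by (intro indep_var_restrict[of _ _ "endo M"]) auto
  then have "indep_set (sets (sigma_others M Y))
      (sigma_sets (space (sample M)) {?R {Y} -` C \<inter> space (sample M) |C. C \<in> sets (PiM {Y} ?N)})"
    unfolding indep_var_eq sigma_others_def sets_vimage_algebra by blast
  \<comment> \<open>The second block is a vector with the single component \<open>Y\<close>; each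
    event of \<open>exo_vec M Y\<close> is an event of that vector through the coordinate
    projection.\<close>
  moreover have "exo_vec M Y -` B \<inter> space (sample M)
      \<in> sigma_sets (space (sample M)) {?R {Y} -` C \<inter> space (sample M) |C. C \<in> sets (PiM {Y} ?N)}"
    if B: "B \<in> sets (?N Y)" for B
  proof -
    have "exo_vec M Y -` B \<inter> space (sample M)
      = ?R {Y} -` ((\<lambda>f. f Y) -` B \<inter> space (PiM {Y} ?N)) \<inter> space (sample M)"
    using measurable_space[OF exo_vec_measurable[OF Y]] by (auto simp: space_PiM)
    moreover have "(\<lambda>f. f Y) -` B \<inter> space (PiM {Y} ?N) \<in> sets (PiM {Y} ?N)"
      using B by (intro measurable_sets[OF measurable_component_singleton]) auto
    ultimately show ?thesis
      by (intro sigma_sets.Basic CollectI exI[of _ "(\<lambda>f. f Y) -` B \<inter> space (PiM {Y} ?N)"]) auto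
  qed
  ultimately show ?thesis
    unfolding indep_sets2_eq by blast
qed

lemma subalgebra_sigma_gen:
  assumes Y: "sink M Y" and A: "A \<subseteq> endo M - {Y}"
  shows "subalgebra (sigma_others M Y) (sigma_gen M A)"
  unfolding subalgebra_def sigma_gen_def
  using endo_val_measurable_others[OF Y] A
  by (intro conjI sets_image_in_sets measurable_restrict) auto

lemma parents_sink:
  "sink M Y \<Longrightarrow> parents M Y \<subseteq> endo M - {Y}"
  using parents_subset unfolding sink_def by blast

lemma near_event_sets:
  assumes Y: "sink M Y" and A: "A \<subseteq> endo M - {Y}"
  shows "near_event M A p r \<in> sets (sigma_others M Y)"
proof -
  have "{\<omega> \<in> space (sigma_others M Y). \<forall>j\<in>A. \<bar>endo_val M \<omega> j - p j\<bar> < r} \<in> sets (sigma_others M Y)"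
  proof (rule sets.sets_Collect_finite_All)
    show "finite A"
      using A finite_endo finite_subset by blast
    fix j assume "j \<in> A"
    then have [measurable]: "(\<lambda>\<omega>. endo_val M \<omega> j) \<in> borel_measurable (sigma_others M Y)"
      using endo_val_measurable_others[OF Y] A by blast
    show "{\<omega> \<in> space (sigma_others M Y). \<bar>endo_val M \<omega> j - p j\<bar> < r} \<in> sets (sigma_others M Y)"
      by measurable
  qed
  then show ?thesis by (simp add: near_event_def)
qed

lemma plug_in_parents:
  "p \<in> parents M k \<rightarrow>\<^sub>E UNIV \<Longrightarrow> plug_in M k (parents M k) p \<omega> = mech M k p (exo_vec M k \<omega>)"
proof -
  assume "p \<in> parents M k \<rightarrow>\<^sub>E UNIV"
  then have "restrict (override_on (endo_val M \<omega>) p (parents M k)) (parents M k) = p"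
    by (auto simp: fun_eq_iff restrict_def override_on_def PiE_iff extensional_def)
  then show ?thesis by (simp add: plug_in_def)
qed

text \<open>With all parents set to \<open>p\<close>, the mechanism of \<open>Y\<close> depends on
  the noise of \<open>Y\<close> only, while closeness of the parents to \<open>p\<close> is decided
  by the other noise. Conditioning therefore has no effect at any radius, and the limit that defines
  \<open>m p\<close> is that of a constant.\<close>

lemma cond_exp_fun_eq_expectation:
  assumes ind: "independent_exo M" and Y: "sink M Y"
    and m: "is_cond_exp_fun M Y (parents M Y) m" and p: "p \<in> parents M Y \<rightarrow>\<^sub>E UNIV"
  shows "m p = (\<integral>\<omega>. mech M Y p (exo_vec M Y \<omega>) \<partial>sample M)"
proof -
  let ?E = "\<integral>\<omega>. mech M Y p (exo_vec M Y \<omega>) \<partial>sample M"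
  let ?L = "PiM (exo_of M Y) (exo_space M)"
  have YM: "Y \<in> endo M" using Y by (simp add: sink_def)
  have plug: "plug_in M Y (parents M Y) p = (\<lambda>\<omega>. mech M Y p (exo_vec M Y \<omega>))"
    using plug_in_parents[OF p] by blast
  have int: "integrable (sample M) (\<lambda>\<omega>. mech M Y p (exo_vec M Y \<omega>))"
    and lim: "((\<lambda>r. cond_exp_near M Y (parents M Y) p r) \<longlongrightarrow> m p) (at_right 0)"
    using m p unfolding is_cond_exp_fun_def plug[symmetric] by blast+
  have "(\<lambda>(\<omega>, u). mech M Y p u) \<in> borel_measurable (sigma_others M Y \<Otimes>\<^sub>M ?L)"
    using measurable_compose[OF measurable_Pair[OF measurable_const measurable_snd]
        mech_measurable[OF YM], of p] p by (simp add: space_PiM split_def)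
  note freeze = integral_freeze(2)[OF subalgebra_sigma_others exo_vec_measurable[OF YM]
      indep_sigma_others[OF ind YM] this, unfolded prod.case, OF int]
  \<comment> \<open>If the near event has positive probability, this factor cancels; if it is null,
    the default in \<open>cond_exp_near\<close> is already \<open>?E\<close>.\<close>
  have "cond_exp_near M Y (parents M Y) p r = ?E" for r
  proof -
    let ?B = "near_event M (parents M Y) p r"
    have B: "?B \<in> sets (sigma_others M Y)"
      by (rule near_event_sets[OF Y parents_sink[OF Y]])
    have "?B \<inter> space (sample M) = ?B"
      by (auto simp: near_event_def)
    then have "(\<integral>\<omega>. indicator ?B \<omega> * mech M Y p (exo_vec M Y \<omega>) \<partial>sample M) = prob ?B * ?E"
      unfolding freeze[OF B] by simp
    then show ?thesis
      by (simp add: cond_exp_near_def plug Let_def)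
  qed
  with lim show ?thesis
    by (simp add: tendsto_const_iff)
qed

text \<open>Without noise, \<open>plug_in\<close> at \<open>p\<close> is constant over the sample
  space, so every elementary conditional expectation equals the mechanism at \<open>p\<close>. The
  argument \<open>\<lambda>_. undefined\<close> is the only extensional function on the empty set of
  background variables.\<close>

lemma cond_exp_fun_deterministic:
  assumes det: "exo_of M k = {}"
    and m: "is_cond_exp_fun M k (parents M k) m" and p: "p \<in> parents M k \<rightarrow>\<^sub>E UNIV"
  shows "m p = mech M k p (\<lambda>_. undefined)"
proof -
  have "exo_vec M k = (\<lambda>_ _. undefined)"
    by (simp add: exo_vec_def det fun_eq_iff)
  then have plug: "plug_in M k (parents M k) p = (\<lambda>_. mech M k p (\<lambda>_. undefined))"
    using plug_in_parents[OF p] by auto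
  have "cond_exp_near M k (parents M k) p r = mech M k p (\<lambda>_. undefined)" for r
  proof -
    have "near_event M (parents M k) p r \<inter> space (sample M) = near_event M (parents M k) p r"
      by (auto simp: near_event_def)
    then show ?thesis
      unfolding cond_exp_near_def Let_def plug by (simp add: prob_space)
  qed
  moreover have "((\<lambda>r. cond_exp_near M k (parents M k) p r) \<longlongrightarrow> m p) (at_right 0)"
    using m p unfolding is_cond_exp_fun_def by blast
  ultimately show ?thesis
    by (simp add: tendsto_const_iff)
qed

text \<open>The altered parent vector \<open>q\<close> is still determined by the noise of the other
  variables, so the noise of \<open>Y\<close> can be averaged out with \<open>q\<close> held fixed,
  which turns the mechanism into the regression function.\<close>

lemma real_cond_exp_modified_parent:
  assumes ind: "independent_exo M" and Y: "sink M Y"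
    and m: "is_cond_exp_fun M Y (parents M Y) m"
    and w: "w \<in> borel_measurable (sigma_others M Y)"
    and q_def: "q = (\<lambda>\<omega>. restrict ((endo_val M \<omega>)(W := w \<omega>)) (parents M Y))"
    and int: "integrable (sample M) (\<lambda>\<omega>. mech M Y (q \<omega>) (exo_vec M Y \<omega>))"
  shows "integrable (sample M) (\<lambda>\<omega>. m (q \<omega>))"
    and "AE \<omega> in sample M.
      real_cond_exp (sample M) (sigma_gen M (parents M Y))
        (\<lambda>\<omega>. mech M Y (q \<omega>) (exo_vec M Y \<omega>)) \<omega>
      = real_cond_exp (sample M) (sigma_gen M (parents M Y)) (\<lambda>\<omega>. m (q \<omega>)) \<omega>"
proof -
  let ?L = "PiM (exo_of M Y) (exo_space M)"
  have YM: "Y \<in> endo M" using Y by (simp add: sink_def)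
  have q: "q \<in> measurable (sigma_others M Y) (PiM (parents M Y) (\<lambda>_. borel))"
    unfolding q_def by (rule modified_endo_val_measurable[OF Y YM w])
  \<comment> \<open>For fixed \<open>\<omega>\<close> the vector \<open>q \<omega>\<close> is a
    single point, at which \<open>m\<close> is the expectation of the mechanism.\<close>
  have mq: "(\<lambda>\<omega>. \<integral>\<omega>'. mech M Y (q \<omega>) (exo_vec M Y \<omega>') \<partial>sample M) = (\<lambda>\<omega>. m (q \<omega>))"
    using cond_exp_fun_eq_expectation[OF ind Y m] by (simp add: q_def)
  have "(\<lambda>(\<omega>, u). mech M Y (q \<omega>) u) \<in> borel_measurable (sigma_others M Y \<Otimes>\<^sub>M ?L)"
    using measurable_compose[OF measurable_Pair[OF measurable_compose[OF measurable_fst q]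
          measurable_snd] mech_measurable[OF YM]] by (simp add: split_def)
  note freeze = real_cond_exp_freeze[OF subalgebra_sigma_others
      subalgebra_sigma_gen[OF Y parents_sink[OF Y]] exo_vec_measurable[OF YM]
      indep_sigma_others[OF ind YM] this, unfolded prod.case mq, OF int]
  show "integrable (sample M) (\<lambda>\<omega>. m (q \<omega>))"
    by (rule freeze(1))
  show "AE \<omega> in sample M.
      real_cond_exp (sample M) (sigma_gen M (parents M Y))
        (\<lambda>\<omega>. mech M Y (q \<omega>) (exo_vec M Y \<omega>)) \<omega>
      = real_cond_exp (sample M) (sigma_gen M (parents M Y)) (\<lambda>\<omega>. m (q \<omega>)) \<omega>"
    by (rule freeze(2))
qed

end

section \<open>Models that differ in one variable\<close>

text \<open>A child of \<open>Y\<close> would be an equivalent variable with the same parents,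
  forcing \<open>Y\<close> into \<open>endo Mt\<close>, the image of \<open>c\<close>. Its preimage
  cannot be \<open>Y\<close>, as \<open>c Y\<close> is new, and any other variable is fixed by
  \<open>c\<close>.\<close>

lemma only_generated_sink:
  assumes "structural_causal_model M" "structural_causal_model Mt"
    and Y: "Y \<in> endo M" and c: "corresponding M Mt c" and gen: "only_generated M Mt c Y"
  shows "sink M Y"
  unfolding sink_def
proof (intro conjI ballI notI)
  fix k assume k: "k \<in> endo M" and par: "Y \<in> parents M k"
  interpret M: structural_causal_model M by fact
  interpret Mt: structural_causal_model Mt by fact
  have "k \<noteq> Y" using M.parents_subset[OF k] par by auto
  with k gen have eq: "equivalent_var M Mt c k" by (simp add: only_generated_def)
  have img: "endo Mt = c ` endo M" using c by (auto simp: corresponding_def bij_betw_def)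
  have "c k \<in> endo Mt"
    using k unfolding img by (rule imageI)
  then have "k \<in> endo Mt"
    using eq by (simp add: equivalent_var_def)
  then have "parents Mt k \<subseteq> endo Mt"
    using Mt.parents_subset by blast
  then have "Y \<in> endo Mt"
    using eq par unfolding equivalent_var_def by blast
  then obtain i where i: "i \<in> endo M" "c i = Y"
    unfolding img by (metis imageE)
  have "i \<noteq> Y"
    using i(2) gen Y unfolding only_generated_def by metis
  then have "equivalent_var M Mt c i"
    using i(1) gen by (simp add: only_generated_def)
  then have "c i = i"
    by (simp add: equivalent_var_def)
  with i(2) \<open>i \<noteq> Y\<close> show False by simp
qed (rule Y)

lemma equivalent_exo_vec:
  "equivalent_var M Mt c k \<Longrightarrow> exo_vec Mt k = exo_vec M k"
  unfolding equivalent_var_def exo_vec_def by (auto intro!: ext restrict_ext)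

text \<open>The solution of \<open>Mt\<close> satisfies the equations of \<open>M\<close> for all
  variables other than \<open>Y\<close>, and since \<open>Y\<close> is a sink these equations
  determine the values there.\<close>

lemma only_generated_endo_val:
  assumes M: "structural_causal_model M" and Mt: "structural_causal_model Mt"
    and Y: "Y \<in> endo M" and c: "corresponding M Mt c" and gen: "only_generated M Mt c Y"
    and \<omega>: "\<omega> \<in> space (sample M)" and k: "k \<in> endo M - {Y}"
  shows "endo_val M \<omega> k = endo_val Mt \<omega> k"
proof (rule structural_causal_model.endo_val_eqI
    [OF M only_generated_sink[OF M Mt Y c gen] \<omega> _ k])
  fix i assume i: "i \<in> endo M - {Y}"
  with gen have eq: "equivalent_var M Mt c i" by (simp add: only_generated_def)
  have "c i \<in> endo Mt"
    using i c by (auto simp: corresponding_def dest: bij_betw_apply)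
  then have "i \<in> endo Mt"
    using eq by (simp add: equivalent_var_def)
  moreover have "\<omega> \<in> space (sample Mt)"
    using \<omega> c by (simp add: corresponding_def)
  ultimately show "endo_val Mt \<omega> i = mech M i (restrict (endo_val Mt \<omega>) (parents M i)) (exo_vec M i \<omega>)"
    using structural_causal_model.endo_val_eq_mech[OF Mt, of \<omega> i] eq equivalent_exo_vec[OF eq]
    unfolding equivalent_var_def by metis
qed

lemma only_generated_propagate:
  assumes M: "structural_causal_model M" and Mt: "structural_causal_model Mt"
    and Y: "Y \<in> endo M" and c: "corresponding M Mt c" and gen: "only_generated M Mt c Y"
    and \<omega>: "\<omega> \<in> space (sample M)" and "set \<rho> \<subseteq> endo M - {Y}"
  shows "propagate Mt \<omega> k a \<rho> = propagate M \<omega> k a \<rho>"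
  using assms(7)
proof (induction \<rho> arbitrary: k a)
  case (Cons j \<rho>)
  then have j: "j \<in> endo M - {Y}" by simp
  with gen have eq: "equivalent_var M Mt c j" by (simp add: only_generated_def)
  have "parents M j \<subseteq> endo M - {Y}"
    using only_generated_sink[OF M Mt Y c gen] j structural_causal_model.parents_subset[OF M, of j]
    by (auto simp: sink_def)
  then have "restrict ((endo_val Mt \<omega>)(k := a)) (parents M j)
      = restrict ((endo_val M \<omega>)(k := a)) (parents M j)"
    using only_generated_endo_val[OF M Mt Y c gen \<omega> subsetD]
    by (auto simp: fun_eq_iff restrict_def)
  moreover have "parents Mt j = parents M j" "mech Mt j = mech M j"
    using eq by (simp_all add: equivalent_var_def)
  ultimately show ?case
    using Cons.prems by (simp add: equivalent_exo_vec[OF eq] Cons.IH)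
qed simp

section \<open>Causal predictive parity\<close>

theorem proposition2:
  fixes M Mt :: "('v, 'u, 'w, 'b) scm"
    and c :: "'v \<Rightarrow> 'v" and X Y :: 'v and \<pi> :: "'v list" and x\<^sub>0 x\<^sub>1 :: real
  assumes "structural_causal_model M"
    and "structural_causal_model Mt"
    and "Y \<in> endo M"
    and "corresponding M Mt c"
    and "only_generated M Mt c Y"
    and "exo_of Mt (c Y) = {}"
    and "parents Mt (c Y) = parents M Y"
    and "independent_exo M"
    and "directed_path M \<pi>" and "2 \<le> length \<pi>" and "hd \<pi> = X" and "last \<pi> = Y"
    and "predictive_parity_in_derivatives M Mt c \<pi>"
    and "\<And>x. x \<in> {x\<^sub>0, x\<^sub>1} \<Longrightarrow> integrable (sample M) (path_counterfactual M \<pi> x)"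
    and "\<And>x. x \<in> {x\<^sub>0, x\<^sub>1} \<Longrightarrow> integrable (sample Mt) (path_counterfactual Mt (map c \<pi>) x)"
  shows "causal_predictive_parity M Mt c \<pi> x\<^sub>0 x\<^sub>1 (parents M Y)"
proof -
  interpret M: structural_causal_model M by fact
  interpret Mt: structural_causal_model Mt by fact
  note models = assms(1-5)
  have Y: "sink M Y" by (rule only_generated_sink[OF models])
  have sample: "sample Mt = sample M" using assms(4) by (simp add: corresponding_def)
  let ?A = "parents M Y" and ?G = "sigma_gen M (parents M Y)"
  have A: "?A \<subseteq> endo M - {Y}" by (rule M.parents_sink[OF Y])
  have c_id: "c k = k" if "k \<in> endo M - {Y}" for k
    using that assms(5) by (simp add: only_generated_def equivalent_var_def)
  have cA: "c ` ?A = ?A" using c_id A by force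

  obtain \<rho> where \<pi>: "\<pi> = X # \<rho> @ [Y]"
  proof
    have "\<pi> = butlast \<pi> @ [Y]"
      using assms(10,12) by (metis append_butlast_last_id list.size(3) not_numeral_le_zero)
    moreover have "butlast \<pi> = X # tl (butlast \<pi>)"
      using assms(10,11) by (cases \<pi>) auto
    ultimately show "\<pi> = X # tl (butlast \<pi>) @ [Y]" by (metis append_Cons)
  qed
  \<comment> \<open>For a direct edge from \<open>X\<close> to \<open>Y\<close> the list
    \<open>\<rho>\<close> is empty and \<open>W\<close> is \<open>X\<close>.\<close>
  define W where "W = last (X # \<rho>)"
  have edge: "\<pi> ! i \<in> parents M (\<pi> ! Suc i)" and node: "\<pi> ! Suc i \<in> endo M"
    if "Suc i < length \<pi>" for i
    using that assms(9) by (auto simp: directed_path_def)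
  \<comment> \<open>Each of these variables is a parent of its successor on the path, hence differs
    from the sink \<open>Y\<close>.\<close>
  have inner: "set (X # \<rho>) \<subseteq> endo M - {Y}"
  proof
    fix k assume "k \<in> set (X # \<rho>)"
    then obtain i where "i < length (X # \<rho>)" "(X # \<rho>) ! i = k"
      unfolding in_set_conv_nth by blast
    then have "Suc i < length \<pi>" "\<pi> ! i = k"
      by (auto simp: \<pi> nth_append simp flip: append_Cons)
    then show "k \<in> endo M - {Y}"
      using edge[of i] node[of i] Y M.parents_subset by (fastforce simp: sink_def)
  qed
  let ?n = "length \<rho>"
  have last_edge: "Suc ?n < length \<pi>" "\<pi> ! ?n = W" "\<pi> ! Suc ?n = Y"
    by (auto simp: \<pi> W_def nth_append last_conv_nth simp flip: append_Cons)
  have W: "W \<in> ?A" using edge[OF last_edge(1)] last_edge by simp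

  \<comment> \<open>Parity is read off at the final edge, from \<open>W\<close> to \<open>Y\<close>,
    which has index \<open>?n\<close>.\<close>
  obtain m mt where m: "is_cond_exp_fun M Y ?A m" and mt: "is_cond_exp_fun Mt (c Y) ?A mt"
    and diff: "differentiable_in_vars ?A m" "differentiable_in_vars ?A mt"
    and partial': "\<forall>p \<in> ?A \<rightarrow>\<^sub>E UNIV. partial_deriv (c W) mt p = partial_deriv W m (\<lambda>a\<in>?A. p (c a))"
    using assms(13)[unfolded predictive_parity_in_derivatives_def, rule_format, OF last_edge(1)]
    unfolding last_edge Let_def cA by blast
  have partial: "partial_deriv W mt p = partial_deriv W m p" if p: "p \<in> ?A \<rightarrow>\<^sub>E UNIV" for p
  proof -
    have "(\<lambda>a\<in>?A. p (c a)) = p"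
      using p c_id[OF subsetD[OF A]] by (auto simp: fun_eq_iff restrict_def PiE_iff extensional_def)
    then show ?thesis using partial' p c_id[OF subsetD[OF A W]] by simp
  qed
  have finA: "finite ?A" using A M.finite_endo finite_subset by blast

  define q where "q x = (\<lambda>\<omega>. restrict ((endo_val M \<omega>)(W := propagate M \<omega> X x \<rho>)) ?A)" for x
  define D where "D = (\<lambda>\<omega>. m (restrict (endo_val M \<omega>) ?A) - mt (restrict (endo_val M \<omega>) ?A))"
  \<comment> \<open>The altered and the natural parent vector differ at most in coordinate
    \<open>W\<close>, in which \<open>m - mt\<close> is constant. All dependence on \<open>x\<close>
    disappears here.\<close>
  have D: "m (q x \<omega>) - mt (q x \<omega>) = D \<omega>" for x \<omega>
  proof -
    have "q x \<omega> = (restrict (endo_val M \<omega>) ?A)(W := propagate M \<omega> X x \<rho>)"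
      using W by (auto simp: q_def fun_eq_iff)
    then show ?thesis
      using partial_deriv_eq_imp_diff_const[OF finA W diff partial,
          of "restrict (endo_val M \<omega>) ?A"] by (simp add: D_def)
  qed
  have pcM: "path_counterfactual M \<pi> x = (\<lambda>\<omega>. mech M Y (q x \<omega>) (exo_vec M Y \<omega>))" for x
    by (simp add: path_counterfactual_def \<pi> propagate_snoc q_def W_def fun_eq_iff)
  have pcMt: "path_counterfactual Mt (map c \<pi>) x \<omega> = mt (q x \<omega>)" if \<omega>: "\<omega> \<in> space (sample M)" for x \<omega>
  proof -
    have "map c (X # \<rho>) = X # \<rho>"
      using inner c_id by (intro map_idI) blast
    then have "path_counterfactual Mt (map c \<pi>) x \<omega> = propagate Mt \<omega> X x (\<rho> @ [c Y])"
      by (simp add: path_counterfactual_def \<pi>)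
    also have "\<dots> = mech Mt (c Y)
        (restrict ((endo_val Mt \<omega>)(W := propagate Mt \<omega> X x \<rho>)) ?A) (\<lambda>_. undefined)"
      by (simp add: propagate_snoc W_def assms(6,7) exo_vec_def restrict_def)
    also have "propagate Mt \<omega> X x \<rho> = propagate M \<omega> X x \<rho>"
      using inner by (intro only_generated_propagate[OF models \<omega>]) simp
    also have "restrict ((endo_val Mt \<omega>)(W := propagate M \<omega> X x \<rho>)) ?A = q x \<omega>"
      using only_generated_endo_val[OF models \<omega> subsetD[OF A]] by (auto simp: q_def fun_eq_iff restrict_def)
    also have "mech Mt (c Y) (q x \<omega>) (\<lambda>_. undefined) = mt (q x \<omega>)"
      by (rule Mt.cond_exp_fun_deterministic[OF assms(6), symmetric])
         (use mt in \<open>auto simp: assms(7) q_def PiE_iff extensional_def\<close>)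
    finally show ?thesis .
  qed

  interpret G: finite_measure_subalgebra "sample M" ?G
    by unfold_locales
       (rule subalgebra_trans[OF M.subalgebra_sigma_others M.subalgebra_sigma_gen[OF Y A]])
  have contrast: "AE \<omega> in sample M.
      real_cond_exp (sample M) ?G (path_counterfactual M \<pi> x) \<omega>
      - real_cond_exp (sample M) ?G (path_counterfactual Mt (map c \<pi>) x) \<omega>
      = real_cond_exp (sample M) ?G D \<omega>" if x: "x \<in> {x\<^sub>0, x\<^sub>1}" for x
  proof -
    let ?pc = "path_counterfactual Mt (map c \<pi>) x"
    have w: "(\<lambda>\<omega>. propagate M \<omega> X x \<rho>) \<in> borel_measurable (sigma_others M Y)"
      using inner by (intro M.propagate_measurable_others[OF Y]) auto
    note cond = M.real_cond_exp_modified_parent[OF assms(8) Y m w q_def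
        assms(14)[OF x, unfolded pcM], folded pcM]
    have pc_int: "integrable (sample M) ?pc"
      using assms(15)[OF x] by (simp add: sample)
    have D_eq: "m (q x \<omega>) - ?pc \<omega> = D \<omega>" if "\<omega> \<in> space (sample M)" for \<omega>
      using pcMt[OF that] D by simp
    have diff_int: "integrable (sample M) (\<lambda>\<omega>. m (q x \<omega>) - ?pc \<omega>)"
      using cond(1) pc_int by (rule Bochner_Integration.integrable_diff)
    \<comment> \<open>Integrability of \<open>D\<close> comes from the counterfactual side: on the
      sample space it coincides with a difference of two integrable functions.\<close>
    then have D_int: "integrable (sample M) D"
      by (subst (asm) Bochner_Integration.integrable_cong[OF refl D_eq]) auto
    have "AE \<omega> in sample M. real_cond_exp (sample M) ?G (\<lambda>\<omega>. m (q x \<omega>) - ?pc \<omega>) \<omega>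
        = real_cond_exp (sample M) ?G D \<omega>"
      using diff_int D_int D_eq by (intro G.real_cond_exp_cong) auto
    with cond(2) G.real_cond_exp_diff[OF cond(1) pc_int] show ?thesis
      by eventually_elim simp
  qed
  \<comment> \<open>The right-hand side of \<open>contrast\<close> is the same for
    \<open>x\<^sub>0\<close> and \<open>x\<^sub>1\<close>; equating the two left-hand sides and
    rearranging gives the claim.\<close>
  have "AE \<omega> in sample M.
      real_cond_exp (sample M) ?G (path_counterfactual M \<pi> x\<^sub>1) \<omega>
      - real_cond_exp (sample M) ?G (path_counterfactual M \<pi> x\<^sub>0) \<omega>
      = real_cond_exp (sample M) ?G (path_counterfactual Mt (map c \<pi>) x\<^sub>1) \<omega>
      - real_cond_exp (sample M) ?G (path_counterfactual Mt (map c \<pi>) x\<^sub>0) \<omega>"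
    using contrast[of x\<^sub>0, simplified] contrast[of x\<^sub>1, simplified] by eventually_elim simp
  then show ?thesis
    unfolding causal_predictive_parity_def sample .
qed

end
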